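(* Let $q$ be an odd prime power and $n$ a prime with $(q^n-1)/2$ even, let $Q=\frac{q^n-1}{q-1}$ and $\beta\in\mathbb{F}_q^*$. Write the product of the distinct primes dividing $q^n-1$ as $k p_1\cdots p_s$ with $s\ge0$ and $p_1,\dots,p_s$ distinct primes (not dividing $k$), ordered so that $p_i\mid Q$ for $1\le i\le r$ and $p_i\nmid Q$ for $r<i\le s$. Let $\delta=1-\sum_{i=1}^s\frac1{p_i}$ ($\delta=1$ if $s=0$), $\delta_Q=1-\sum_{i=1}^r\frac1{p_i}$, and let $k_Q$ be the product of the primes dividing $k$ which divide $Q$. Assume $\delta>0$. Then $$\mathcal{N}_\beta(q^n-1)\ \ge\ \delta\,\theta(k)\,q^{\frac{n-1}{2}}\left\{q^{\frac{n-1}{2}}-4\left(\frac{s-1}{\delta}+2\right)W(k)+2\left(\frac{r-1+\delta_Q}{\delta}+1\right)W(k_Q)\right\}.$$ Hence, if $$q^{\frac{n-1}{2}}>4\left(\frac{s-1}{\delta}+2\right)W(k)-2\left(\frac{r-1+\delta_Q}{\delta}+1\right)W(k_Q),$$ then $\mathcal{N}_\beta(q^n-1)>0$.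
   Context: For a divisor $m$ of $q^n-1$, $\xi\in\mathbb{F}_{q^n}^*$ is $m$-free if $\xi=\zeta^d$ with $d\mid m$, $\zeta\in\mathbb{F}_{q^n}^*$ implies $d=1$. $\mathcal{N}_\beta(m)$ is the number of $m$-free $\xi\in\mathbb{F}_{q^n}^*$ with $\mathrm{Tr}(\xi^2)=\beta$, where $\mathrm{Tr}:\mathbb{F}_{q^n}\to\mathbb{F}_q$ is the trace. $\theta(m)=\phi(m)/m$ with $\phi$ Euler's function, and $W(m)=2^{\nu(m)}$ with $\nu(m)$ the number of distinct prime divisors of $m$. *)

theory Defs
  imports Complex_Main "HOL-Library.Cardinality" "HOL-Number_Theory.Number_Theory"
begin

definition is_subfield :: "'a::field set \<Rightarrow> bool" where
  "is_subfield F \<longleftrightarrow> 0 \<in> F \<and> 1 \<in> F \<and>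
     (\<forall>x\<in>F. \<forall>y\<in>F. x - y \<in> F \<and> x * y \<in> F) \<and> (\<forall>x\<in>F. inverse x \<in> F)"

text \<open>The trace of the extension of degree \<open>n\<close> of the field with \<open>q\<close> elements, as the sum of
  the conjugates.  It is used on a field with \<open>q ^ n\<close> elements only; its values then lie in
  the subfield with \<open>q\<close> elements.\<close>

definition field_trace :: "nat \<Rightarrow> nat \<Rightarrow> 'a::field \<Rightarrow> 'a" where
  "field_trace q n x = (\<Sum>i<n. x ^ (q ^ i))"

definition m_free :: "nat \<Rightarrow> 'a::field \<Rightarrow> bool" where
  "m_free m \<xi> \<longleftrightarrow> \<xi> \<noteq> 0 \<and> (\<forall>d \<zeta>. d dvd m \<and> \<zeta> \<noteq> 0 \<and> \<xi> = \<zeta> ^ d \<longrightarrow> d = 1)"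

definition N_free :: "nat \<Rightarrow> nat \<Rightarrow> 'a::{field,finite} \<Rightarrow> nat \<Rightarrow> nat" where
  "N_free q n \<beta> m = card {\<xi>::'a. m_free m \<xi> \<and> field_trace q n (\<xi>\<^sup>2) = \<beta>}"

definition \<theta> :: "nat \<Rightarrow> real" where
  "\<theta> m = real (totient m) / real m"

definition \<nu> :: "nat \<Rightarrow> nat" where
  "\<nu> m = card (prime_factors m)"

definition W :: "nat \<Rightarrow> nat" where
  "W m = 2 ^ \<nu> m"

end

theory Submission
  imports Defs "HOL-Computational_Algebra.Polynomial" "HOL-Analysis.Complex_Transcendental"
begin

text \<open>
  Let \<open>L\<close> be a nonzero \<open>F\<close>-linear functional with fibres of size \<open>H\<close>, and write \<open>U b\<close> for the
  sum of a nontrivial multiplicative character \<open>\<psi>\<close> over \<open>{y. L y = b}\<close>. Scaling by \<open>F\<close> shows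
  that \<open>\<bar>U b\<bar>\<close> is the same for all \<open>b \<noteq> 0\<close>, and the substitution \<open>x = t * y\<close> evaluates the
  second moment of \<open>U\<close>; hence \<open>\<bar>U b\<bar> \<le> sqrt H\<close> without any Gauss sums. The sum of \<open>\<psi>\<close> over
  \<open>{x. L (x\<^sup>2) = b}\<close> vanishes if \<open>\<psi> (- 1) = - 1\<close>; otherwise \<open>\<psi> = \<eta>\<^sup>2\<close>, and it is the sum of the
  fibre sums of \<open>\<eta>\<close> and \<open>\<rho> \<eta>\<close> with the quadratic character \<open>\<rho>\<close>, so at most \<open>2 * sqrt H\<close>.

  Let \<open>A\<close> be any set of units on which all nontrivial character sums are at most \<open>C\<close>. Being no
  \<open>l\<close>-th power is, up to the factor \<open>1 - 1 / l\<close>, the indicator \<open>1 - B l\<close>, where \<open>B l\<close> is the mean of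
  the characters of order \<open>l\<close>. A product of such means over distinct primes is a mean of nontrivial
  characters, so each factor \<open>1 - B l\<close> at most doubles the error, and the usual prime sieve applies.

  For the trace this gives the bound with the error term \<open>2 * ((s - 1) / \<delta> + 2) * W k\<close> in place of
  the two terms of the theorem. This is stronger, because
  \<open>(r - 1 + \<delta>Q) / \<delta> + 1 \<le> (s - 1) / \<delta> + 2\<close> and \<open>W kQ \<le> W k\<close>.
\<close>

section \<open>Subfields and primitive elements of finite fields\<close>

lemma one_less_card_subfield:
  fixes F :: "'a::{field,finite} set"
  assumes "is_subfield F"
  shows "card F > 1"
proof -
  have "{0, 1} \<subseteq> F" using assms by (simp add: is_subfield_def)
  hence "card {0, 1::'a} \<le> card F" by (intro card_mono) simp_all
  thus ?thesis by simp
qed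

lemma is_subfield_UNIV: "is_subfield UNIV"
  by (simp add: is_subfield_def)

lemma subfield_power_card_minus_1:
  fixes F :: "'a::{field,finite} set"
  assumes "is_subfield F" "x \<in> F" "x \<noteq> 0"
  shows "x ^ (card F - 1) = 1"
proof -
  have "\<Prod>(F - {0}) = (\<Prod>y\<in>F - {0}. x * y)"
    by (rule prod.reindex_bij_witness[of _ "\<lambda>y. x * y" "\<lambda>y. inverse x * y"])
      (use assms in \<open>auto simp: is_subfield_def\<close>)
  also have "\<dots> = x ^ (card F - 1) * \<Prod>(F - {0})"
    using assms(1) by (simp add: prod.distrib card_Diff_singleton is_subfield_def)
  finally show ?thesis by simp
qed

lemma subfield_power_card:
  fixes F :: "'a::{field,finite} set"
  assumes "is_subfield F" "x \<in> F"
  shows "x ^ card F = x"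
proof (cases "x = 0")
  case False
  have "x ^ (card F - 1) * x = x ^ card F"
    using one_less_card_subfield[OF assms(1)] by (intro power_minus_mult) simp
  thus ?thesis by (simp only: subfield_power_card_minus_1[OF assms False] mult_1)
qed (use one_less_card_subfield[OF assms(1)] in simp)

lemmas one_less_CARD = one_less_card_subfield[OF is_subfield_UNIV]
lemmas finite_field_power_card_minus_1 = subfield_power_card_minus_1[OF is_subfield_UNIV UNIV_I]

lemma prime_CHAR_finite_field: "prime CHAR('a::{field,finite})"
  by (intro prime_CHAR_semidom finite_imp_CHAR_pos) simp

lemma subfield_eq_fixed_points:
  fixes F :: "'a::{field,finite} set"
  assumes "is_subfield F"
  shows "F = {x. x ^ card F = x}"
proof (rule card_subset_eq)
  show F_subset: "F \<subseteq> {x. x ^ card F = x}" using subfield_power_card[OF assms] by auto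
  let ?p = "monom 1 (card F) - monom 1 1 :: 'a poly"
  have "card F > 1" by (rule one_less_card_subfield[OF assms])
  hence "coeff ?p (card F) = 1" and "degree ?p \<le> card F"
    by (auto intro!: degree_diff_le simp: degree_monom_eq)
  moreover from this have "?p \<noteq> 0" by (metis coeff_0 zero_neq_one)
  moreover have "{x. poly ?p x = 0} = {x. x ^ card F = x}" by (auto simp: poly_monom)
  ultimately have "card {x::'a. x ^ card F = x} \<le> card F"
    using card_poly_roots_bound[of ?p] by auto
  thus "card F = card {x::'a. x ^ card F = x}"
    using card_mono[OF _ F_subset] by simp
qed simp

definition primitive_element :: "'a::field \<Rightarrow> bool" where
  "primitive_element g \<longleftrightarrow> g \<noteq> 0 \<and> (\<forall>x. x \<noteq> 0 \<longrightarrow> (\<exists>i::nat. x = g ^ i))"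

lemma primitive_element_exists: "\<exists>g::'a::{field,finite}. primitive_element g"
proof -
  define R :: "'a ring" where
    "R = \<lparr>carrier = UNIV, monoid.mult = (*), one = 1, ring.zero = 0, add = (+)\<rparr>"
  interpret R: Ring.field R
  proof -
    have "cring R"
      by (intro cringI abelian_groupI comm_monoidI)
        (auto simp: R_def algebra_simps intro: exI[of _ "- x" for x])
    moreover have "\<exists>y. x * y = 1" if "x \<noteq> 0" for x :: 'a
      by (rule exI[of _ "inverse x"]) (simp add: that)
    ultimately show "Ring.field R"
      by (intro cring.cring_fieldI2) (auto simp: R_def)
  qed
  have power: "x [^]\<^bsub>R\<^esub> (i::nat) = x ^ i" for x i
    by (induction i) (simp_all add: R_def mult.commute)
  have "finite (carrier R)" by (simp add: R_def)
  from R.finite_field_mult_group_has_gen[OF this] obtain g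
    where "g \<in> carrier (mult_of R)" "carrier (mult_of R) = {g [^]\<^bsub>R\<^esub> i |i::nat. i \<in> UNIV}"
    by (auto simp: nat_pow_mult_of)
  hence "primitive_element g"
    unfolding primitive_element_def power by (auto simp: R_def)
  thus ?thesis ..
qed

lemma power_mod_eq_of_power_eq_1:
  fixes g :: "'a::monoid_mult"
  assumes "g ^ N = 1"
  shows "g ^ (i mod N) = g ^ i"
proof -
  have "g ^ i = g ^ (N * (i div N) + i mod N)" by simp
  also have "\<dots> = g ^ (i mod N)" by (simp only: power_add power_mult assms) simp
  finally show ?thesis ..
qed

lemma primitive_element_power_eq_iff:
  fixes g :: "'a::{field,finite}"
  assumes g: "primitive_element g"
  shows "g ^ i = g ^ j \<longleftrightarrow> i mod (CARD('a) - 1) = j mod (CARD('a) - 1)"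
proof -
  define N where "N = CARD('a) - 1"
  have "N > 0" using one_less_CARD[where 'a = 'a] by (simp add: N_def)
  have period: "g ^ N = 1"
    using g finite_field_power_card_minus_1 by (auto simp: primitive_element_def N_def)
  have "UNIV - {0} \<subseteq> (\<lambda>i. g ^ i) ` {..<N}"
  proof
    fix x :: 'a assume "x \<in> UNIV - {0}"
    then obtain i where "x = g ^ i" using g by (auto simp: primitive_element_def)
    hence "x = g ^ (i mod N)" by (simp add: power_mod_eq_of_power_eq_1 period)
    thus "x \<in> (\<lambda>i. g ^ i) ` {..<N}" using \<open>N > 0\<close> by auto
  qed
  hence "card (UNIV - {0::'a}) \<le> card ((\<lambda>i. g ^ i) ` {..<N})"
    by (intro card_mono) auto
  moreover have "card (UNIV - {0::'a}) = N" by (simp add: N_def card_Diff_singleton)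
  ultimately have "inj_on (\<lambda>i. g ^ i) {..<N}"
    using card_image_le[of "{..<N}" "\<lambda>i. g ^ i"] by (intro eq_card_imp_inj_on) auto
  hence "g ^ (i mod N) = g ^ (j mod N) \<longleftrightarrow> i mod N = j mod N"
    using \<open>N > 0\<close> by (auto simp: inj_on_def)
  thus ?thesis unfolding N_def[symmetric] by (simp add: power_mod_eq_of_power_eq_1 period)
qed

section \<open>Multiplicative characters\<close>

definition mult_char :: "('a::field \<Rightarrow> complex) \<Rightarrow> bool" where
  "mult_char \<psi> \<longleftrightarrow> \<psi> 0 = 0 \<and> \<psi> 1 = 1 \<and> (\<forall>x y. \<psi> (x * y) = \<psi> x * \<psi> y)"

definition nontrivial :: "('a::field \<Rightarrow> complex) \<Rightarrow> bool" where
  "nontrivial \<psi> \<longleftrightarrow> (\<exists>x. x \<noteq> 0 \<and> \<psi> x \<noteq> 1)"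

definition char_has_order :: "('a::field \<Rightarrow> complex) \<Rightarrow> nat \<Rightarrow> bool" where
  "char_has_order \<psi> l \<longleftrightarrow> (\<forall>j. (\<forall>x. x \<noteq> 0 \<longrightarrow> \<psi> x ^ j = 1) \<longleftrightarrow> l dvd j)"

lemma mult_charD:
  assumes "mult_char \<psi>"
  shows "\<psi> 0 = 0" "\<psi> 1 = 1" "\<psi> (x * y) = \<psi> x * \<psi> y"
  using assms by (auto simp: mult_char_def)

lemma mult_char_apply_power: "mult_char \<psi> \<Longrightarrow> \<psi> (x ^ k) = \<psi> x ^ k"
  by (induction k) (simp_all add: mult_charD)

lemma mult_char_mult: "mult_char \<psi> \<Longrightarrow> mult_char \<eta> \<Longrightarrow> mult_char (\<lambda>x. \<psi> x * \<eta> x)"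
  by (simp add: mult_char_def)

lemma mult_char_power: "mult_char \<psi> \<Longrightarrow> j > 0 \<Longrightarrow> mult_char (\<lambda>x. \<psi> x ^ j)"
  by (simp add: mult_char_def power_mult_distrib)

lemma norm_mult_char:
  fixes \<psi> :: "'a::{field,finite} \<Rightarrow> complex"
  assumes "mult_char \<psi>" "x \<noteq> 0"
  shows "norm (\<psi> x) = 1"
proof -
  have "\<psi> x ^ (CARD('a) - 1) = \<psi> (x ^ (CARD('a) - 1))"
    by (rule mult_char_apply_power[OF assms(1), symmetric])
  also have "\<dots> = 1"
    by (simp only: finite_field_power_card_minus_1[OF assms(2)] mult_charD[OF assms(1)])
  finally have "norm (\<psi> x) = 1 \<or> CARD('a) - 1 = 0" by (rule power_eq_1_iff)
  thus ?thesis using one_less_CARD[where 'a = 'a] by simp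
qed

lemma mult_char_divide:
  fixes \<psi> :: "'a::{field,finite} \<Rightarrow> complex"
  assumes "mult_char \<psi>"
  shows "\<psi> (x / y) = \<psi> x * cnj (\<psi> y)"
proof (cases "y = 0")
  case False
  have "\<psi> x * cnj (\<psi> y) = \<psi> (x / y * y) * cnj (\<psi> y)" using False by simp
  also have "\<dots> = \<psi> (x / y) * (\<psi> y * cnj (\<psi> y))"
    by (simp only: mult_charD[OF assms] mult.assoc)
  also have "\<psi> y * cnj (\<psi> y) = 1"
    using norm_mult_char[OF assms False] by (simp flip: complex_norm_square)
  finally show ?thesis by simp
qed (simp add: mult_charD[OF assms])

lemma sum_mult_char_nontrivial:
  fixes \<psi> :: "'a::{field,finite} \<Rightarrow> complex"
  assumes "mult_char \<psi>" "nontrivial \<psi>"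
  shows "(\<Sum>x\<in>UNIV. \<psi> x) = 0"
proof -
  obtain c where c: "c \<noteq> 0" "\<psi> c \<noteq> 1" using assms by (auto simp: nontrivial_def)
  have "(\<Sum>x\<in>UNIV. \<psi> x) = (\<Sum>x\<in>UNIV. \<psi> (c * x))"
    by (rule sum.reindex_bij_witness[of _ "\<lambda>y. c * y" "\<lambda>y. y / c"]) (use c in auto)
  also have "\<dots> = \<psi> c * (\<Sum>x\<in>UNIV. \<psi> x)"
    by (simp add: mult_charD[OF assms(1)] sum_distrib_left)
  finally show ?thesis using c by simp
qed

lemma mult_char_with_value_exists:
  fixes g :: "'a::{field,finite}"
  assumes g: "primitive_element g" and w: "w ^ (CARD('a) - 1) = 1"
  shows "\<exists>\<psi>. mult_char \<psi> \<and> \<psi> g = w"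
proof -
  define ind where "ind = (\<lambda>x. SOME i::nat. x = g ^ i)"
  define \<psi> where "\<psi> = (\<lambda>x. if x = 0 then 0 else w ^ ind x)"
  have "g \<noteq> 0" using g by (simp add: primitive_element_def)
  have ind: "x = g ^ ind x" if "x \<noteq> 0" for x
    unfolding ind_def by (rule someI_ex) (use g that in \<open>auto simp: primitive_element_def\<close>)
  have \<psi>_power: "\<psi> (g ^ i) = w ^ i" for i
  proof -
    have "g ^ i = g ^ ind (g ^ i)" by (rule ind) (simp add: \<open>g \<noteq> 0\<close>)
    hence "i mod (CARD('a) - 1) = ind (g ^ i) mod (CARD('a) - 1)"
      using primitive_element_power_eq_iff[OF g] by blast
    hence "w ^ i = w ^ ind (g ^ i)" by (metis power_mod_eq_of_power_eq_1 w)
    thus ?thesis by (simp add: \<psi>_def \<open>g \<noteq> 0\<close>)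
  qed
  have "\<psi> (x * y) = \<psi> x * \<psi> y" for x y
  proof (cases "x = 0 \<or> y = 0")
    case False
    then obtain i j where ij: "x = g ^ i" "y = g ^ j"
      using g unfolding primitive_element_def by blast
    hence "x * y = g ^ (i + j)" by (simp add: power_add)
    thus ?thesis using ij by (metis \<psi>_power power_add)
  qed (auto simp: \<psi>_def)
  moreover have "\<psi> 1 = 1" using \<psi>_power[of 0] by simp
  moreover have "\<psi> g = w" using \<psi>_power[of 1] by simp
  moreover have "\<psi> 0 = 0" by (simp add: \<psi>_def)
  ultimately show ?thesis by (auto simp: mult_char_def)
qed

lemma mult_char_eqI:
  assumes "primitive_element g" "mult_char \<psi>" "mult_char \<eta>" "\<psi> g = \<eta> g"
  shows "\<psi> = \<eta>"
proof
  show "\<psi> x = \<eta> x" for x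
  proof (cases "x = 0")
    case False
    then obtain i where "x = g ^ i" using assms(1) unfolding primitive_element_def by blast
    thus ?thesis using assms by (simp add: mult_char_apply_power)
  qed (use assms in \<open>simp add: mult_charD\<close>)
qed

lemma char_has_order_iff_primitive_element:
  assumes g: "primitive_element g" and \<psi>: "mult_char \<psi>"
  shows "char_has_order \<psi> l \<longleftrightarrow> (\<forall>j. \<psi> g ^ j = 1 \<longleftrightarrow> l dvd j)"
proof -
  have "(\<forall>x. x \<noteq> 0 \<longrightarrow> \<psi> x ^ j = 1) \<longleftrightarrow> \<psi> g ^ j = 1" for j
  proof
    assume g_power: "\<psi> g ^ j = 1"
    have "\<psi> (g ^ i) ^ j = (\<psi> g ^ j) ^ i" for i
      by (simp add: mult_char_apply_power[OF \<psi>] mult.commute flip: power_mult)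
    thus "\<forall>x. x \<noteq> 0 \<longrightarrow> \<psi> x ^ j = 1" using g g_power by (auto simp: primitive_element_def)
  qed (use g in \<open>simp add: primitive_element_def\<close>)
  thus ?thesis by (simp add: char_has_order_def)
qed

lemma char_has_order_power_eq_1: "char_has_order \<psi> l \<Longrightarrow> x \<noteq> 0 \<Longrightarrow> \<psi> x ^ l = 1"
  unfolding char_has_order_def by (metis dvd_refl)

lemma char_has_order_imp_nontrivial:
  assumes "char_has_order \<psi> l" "l > 1"
  shows "nontrivial \<psi>"
proof -
  have "\<not> l dvd 1" using assms(2) by simp
  hence "\<not> (\<forall>x. x \<noteq> 0 \<longrightarrow> \<psi> x ^ 1 = 1)"
    using assms(1) unfolding char_has_order_def by blast
  thus ?thesis by (simp add: nontrivial_def)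
qed

lemma mult_char_with_order_exists:
  assumes "l dvd CARD('a::{field,finite}) - 1"
  shows "\<exists>\<psi>::'a \<Rightarrow> complex. mult_char \<psi> \<and> char_has_order \<psi> l"
proof -
  obtain g :: 'a where g: "primitive_element g" using primitive_element_exists by blast
  have "l > 0" using assms one_less_CARD[where 'a = 'a]
    by (intro Nat.gr0I) auto
  define w where "w = exp (2 * of_real pi * \<i> / of_nat l)"
  have w_power: "w ^ j = 1 \<longleftrightarrow> l dvd j" for j
  proof -
    have "w ^ j = exp (2 * of_real pi * \<i> * of_nat j / of_nat l)"
      unfolding w_def by (subst exp_of_nat_mult[symmetric]) (simp add: mult_ac)
    thus ?thesis using complex_root_unity_eq_1[of l j] \<open>l > 0\<close> by simp
  qed
  have "w ^ (CARD('a) - 1) = 1" using assms by (simp only: w_power)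
  then obtain \<psi> where "mult_char \<psi>" "\<psi> g = w" using mult_char_with_value_exists[OF g] by blast
  hence "mult_char \<psi> \<and> char_has_order \<psi> l"
    by (simp add: char_has_order_iff_primitive_element[OF g] w_power)
  thus ?thesis by blast
qed

lemma mult_char_eq_1_iff_power:
  fixes \<psi> :: "'a::{field,finite} \<Rightarrow> complex"
  assumes \<psi>: "mult_char \<psi>" "char_has_order \<psi> l" and "x \<noteq> 0"
  shows "\<psi> x = 1 \<longleftrightarrow> (\<exists>z. x = z ^ l)"
proof
  assume "\<psi> x = 1"
  obtain g :: 'a where g: "primitive_element g" using primitive_element_exists by blast
  then obtain i where i: "x = g ^ i" using \<open>x \<noteq> 0\<close> unfolding primitive_element_def by blast
  hence "\<psi> g ^ i = 1" using \<open>\<psi> x = 1\<close> by (simp add: mult_char_apply_power \<psi>)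
  hence "l dvd i" using \<psi>(2) by (simp add: char_has_order_iff_primitive_element[OF g \<psi>(1)])
  then obtain j where "i = l * j" by (rule dvdE)
  hence "x = (g ^ j) ^ l" by (simp add: i mult.commute flip: power_mult)
  thus "\<exists>z. x = z ^ l" ..
next
  assume "\<exists>z. x = z ^ l"
  then obtain z where z: "x = z ^ l" by blast
  show "\<psi> x = 1"
  proof (cases "z = 0")
    case True
    hence "x = 1" using z \<open>x \<noteq> 0\<close> by (simp add: power_0_left split: if_splits)
    thus ?thesis by (simp add: mult_charD \<psi>)
  next
    case False
    thus ?thesis using z \<psi> by (simp add: mult_char_apply_power char_has_order_power_eq_1)
  qed
qed

lemma mult_char_root_exists:
  fixes \<psi> :: "'a::{field,finite} \<Rightarrow> complex"
  assumes \<psi>: "mult_char \<psi>" "\<And>z. z ^ d = 1 \<Longrightarrow> \<psi> z = 1" and d: "d dvd CARD('a) - 1"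
  shows "\<exists>\<eta>. mult_char \<eta> \<and> \<psi> = (\<lambda>x. \<eta> x ^ d)"
proof -
  obtain g :: 'a where g: "primitive_element g" using primitive_element_exists by blast
  obtain m where m: "CARD('a) - 1 = d * m" using d by (rule dvdE)
  hence "d > 0" using one_less_CARD[where 'a = 'a]
    by (intro Nat.gr0I) auto
  then obtain w where w: "\<psi> g = w ^ d" using exists_complex_root by blast
  have "(g ^ m) ^ d = g ^ (CARD('a) - 1)" by (simp only: m power_mult[symmetric] mult.commute[of d])
  also have "\<dots> = 1" using g finite_field_power_card_minus_1 by (auto simp: primitive_element_def)
  finally have "\<psi> (g ^ m) = 1" by (rule \<psi>(2))
  hence "w ^ (CARD('a) - 1) = 1" by (simp only: m power_mult mult_char_apply_power[OF \<psi>(1)] w)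
  then obtain \<eta> where \<eta>: "mult_char \<eta>" "\<eta> g = w"
    using mult_char_with_value_exists[OF g] by blast
  have "\<psi> = (\<lambda>x. \<eta> x ^ d)"
    by (rule mult_char_eqI[OF g \<psi>(1) mult_char_power[OF \<eta>(1) \<open>d > 0\<close>]]) (simp add: \<eta> w)
  with \<eta> show ?thesis by blast
qed

section \<open>Sieving a set with small character sums\<close>

definition power_bias :: "nat \<Rightarrow> 'a::field \<Rightarrow> real" where
  "power_bias l x = (if \<exists>z. x = z ^ l then 1 else - 1 / (real l - 1))"

lemma one_minus_power_bias:
  assumes "l > 1"
  shows "(1 - 1 / real l) * (1 - power_bias l x) = of_bool (\<nexists>z. x = z ^ l)"
proof -
  have "real l \<noteq> 0" "real l - 1 \<noteq> 0" using assms by simp_all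
  thus ?thesis by (simp add: power_bias_def divide_simps)
qed

lemma power_bias_eq_mean_of_char_powers:
  fixes x :: "'a::{field,finite}"
  assumes \<psi>: "mult_char \<psi>" "char_has_order \<psi> l" and "l > 1" "x \<noteq> 0"
  shows "of_real (power_bias l x) = (\<Sum>j=1..<l. \<psi> x ^ j) / of_nat (l - 1)"
proof (cases "\<psi> x = 1")
  case True
  thus ?thesis using assms mult_char_eq_1_iff_power[OF \<psi> \<open>x \<noteq> 0\<close>] by (simp add: power_bias_def)
next
  case False
  have "(\<Sum>j<l. \<psi> x ^ j) = 0"
    using False char_has_order_power_eq_1[OF \<psi>(2) \<open>x \<noteq> 0\<close>] by (simp add: sum_gp_strict)
  moreover have "(\<Sum>j<l. \<psi> x ^ j) = 1 + (\<Sum>j=1..<l. \<psi> x ^ j)"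
    using \<open>l > 1\<close> by (simp add: lessThan_atLeast0 sum.atLeast_Suc_lessThan)
  ultimately have "(\<Sum>j=1..<l. \<psi> x ^ j) = -1" by (simp add: eq_neg_iff_add_eq_0 add.commute)
  thus ?thesis
    using False \<open>l > 1\<close> mult_char_eq_1_iff_power[OF \<psi> \<open>x \<noteq> 0\<close>]
    by (simp add: power_bias_def of_nat_diff)
qed

lemma eq_1_if_coprime_powers_eq_1:
  fixes w :: "'a::monoid_mult"
  assumes "w ^ a = 1" "w ^ b = 1" "coprime a b"
  shows "w = 1"
proof (cases "a = 0")
  case False
  then obtain x y where "a * x = b * y + 1"
    using bezout_nat[of a b] assms(3) by auto
  hence "w ^ (a * x) = w ^ (b * y) * w" by (simp add: power_commutes)
  thus ?thesis by (simp add: power_mult assms)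
qed (use assms in simp)

lemma mult_char_prod:
  assumes "finite T" "T \<noteq> {}" "\<And>l. l \<in> T \<Longrightarrow> mult_char (\<psi> l)"
  shows "mult_char (\<lambda>x. \<Prod>l\<in>T. \<psi> l x)"
  using assms by (auto simp: mult_char_def prod.distrib)

lemma nontrivial_prod_of_distinct_prime_orders:
  assumes T: "finite T" "l \<in> T" "\<And>l. l \<in> T \<Longrightarrow> prime l"
    and \<psi>: "\<And>l. l \<in> T \<Longrightarrow> char_has_order (\<psi> l) l" and "\<not> l dvd f l"
  shows "nontrivial (\<lambda>x. \<Prod>l\<in>T. \<psi> l x ^ f l)"
proof (rule ccontr)
  assume trivial: "\<not> nontrivial (\<lambda>x. \<Prod>l\<in>T. \<psi> l x ^ f l)"
  define m where "m = \<Prod>(T - {l})"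
  have "nontrivial (\<psi> l)"
    using T \<psi> by (intro char_has_order_imp_nontrivial[of _ l] prime_gt_1_nat)
  then obtain x where x: "x \<noteq> 0" "\<psi> l x \<noteq> 1" by (auto simp: nontrivial_def)
  have others: "\<psi> k x ^ (f k * m) = 1" if "k \<in> T - {l}" for k
  proof -
    have "k dvd m" unfolding m_def using that T(1) by (intro dvd_prodI) auto
    then obtain c where "m = k * c" by (rule dvdE)
    hence "\<psi> k x ^ (f k * m) = (\<psi> k x ^ k) ^ (f k * c)"
      by (simp only: mult.left_commute flip: power_mult)
    also have "\<psi> k x ^ k = 1" using that \<psi> x(1) by (intro char_has_order_power_eq_1) auto
    finally show ?thesis by simp
  qed
  have "1 = (\<Prod>k\<in>T. \<psi> k x ^ f k) ^ m" using trivial x(1) by (auto simp: nontrivial_def)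
  also have "\<dots> = (\<Prod>k\<in>T. \<psi> k x ^ (f k * m))" by (simp add: prod_power_distrib power_mult)
  also have "\<dots> = \<psi> l x ^ (f l * m)" using T others by (subst prod.remove[of _ l]) simp_all
  finally have "\<psi> l x ^ (f l * m) = 1" ..
  moreover have "\<psi> l x ^ l = 1" using T \<psi> x(1) by (intro char_has_order_power_eq_1) auto
  moreover have "coprime (f l * m) l"
  proof -
    have "\<not> l dvd m" unfolding m_def
    proof
      assume "l dvd \<Prod>(T - {l})"
      then obtain k where "k \<in> T - {l}" "l dvd k" using T by (auto simp: prime_dvd_prod_iff)
      thus False using T primes_dvd_imp_eq by blast
    qed
    hence "\<not> l dvd f l * m" using assms T by (simp add: prime_dvd_mult_iff)
    thus ?thesis using T by (metis coprime_commute prime_imp_coprime)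
  qed
  ultimately show False using eq_1_if_coprime_powers_eq_1 x(2) by blast
qed

lemma prod_one_minus_inverse_primes_nonneg:
  assumes "S \<subseteq> prime_factors N"
  shows "(\<Prod>l\<in>S. 1 - 1 / real l) \<ge> 0"
proof (rule prod_nonneg)
  fix l assume "l \<in> S"
  hence "l > 0" using assms by (auto intro: prime_gt_0_nat)
  thus "0 \<le> 1 - 1 / real l" by simp
qed

lemma m_free_iff:
  fixes x :: "'a::field"
  assumes "m > 0"
  shows "m_free m x \<longleftrightarrow> x \<noteq> 0 \<and> (\<forall>l\<in>prime_factors m. \<nexists>z. x = z ^ l)"
proof
  assume free: "m_free m x"
  have False if "l \<in> prime_factors m" "x = z ^ l" for l z
  proof -
    have l: "prime l" "l dvd m" using that(1) by auto
    moreover have "z \<noteq> 0"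
      using free that(2) prime_gt_0_nat[OF l(1)] by (auto simp: m_free_def power_0_left)
    ultimately have "l = 1" using free that(2) by (auto simp: m_free_def)
    thus False using l(1) by simp
  qed
  thus "x \<noteq> 0 \<and> (\<forall>l\<in>prime_factors m. \<nexists>z. x = z ^ l)" using free by (auto simp: m_free_def)
next
  assume non_power: "x \<noteq> 0 \<and> (\<forall>l\<in>prime_factors m. \<nexists>z. x = z ^ l)"
  have "d = 1" if d: "d dvd m" "x = z ^ d" for d z
  proof (rule ccontr)
    assume "d \<noteq> 1"
    then obtain l where l: "prime l" "l dvd d" using prime_factor_nat by blast
    from l(2) obtain e where "d = l * e" by (rule dvdE)
    hence "x = (z ^ e) ^ l" using d by (simp add: mult.commute flip: power_mult)
    moreover have "l \<in> prime_factors m"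
      using l d assms by (auto simp: prime_factors_dvd intro: dvd_trans)
    ultimately show False using non_power by blast
  qed
  thus "m_free m x" using non_power by (auto simp: m_free_def)
qed

lemma prod_mean_eq_mean_prod:
  fixes f :: "'i \<Rightarrow> 'j \<Rightarrow> 'c::field"
  assumes "finite U" "\<And>i. i \<in> U \<Longrightarrow> finite (B i)"
  shows "(\<Prod>i\<in>U. (\<Sum>j\<in>B i. f i j) / of_nat (card (B i)))
    = (\<Sum>g\<in>PiE U B. \<Prod>i\<in>U. f i (g i)) / of_nat (card (PiE U B))"
  using assms by (simp add: prod_dividef prod_sum_PiE card_PiE)

lemma card_Int_INT_ge:
  assumes "finite X" "finite I"
  shows "real (card (X \<inter> (\<Inter>i\<in>I. Y i)))
    \<ge> real (card X) - (\<Sum>i\<in>I. real (card X) - real (card (X \<inter> Y i)))"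
proof -
  have card_Diff: "real (card (X - Z)) = real (card X) - real (card (X \<inter> Z))" for Z
    using assms(1) by (simp add: card_Diff_subset_Int card_mono of_nat_diff)
  have "card (X - (\<Inter>i\<in>I. Y i)) = card (\<Union>i\<in>I. X - Y i)" by (rule arg_cong[of _ _ card]) auto
  also have "\<dots> \<le> (\<Sum>i\<in>I. card (X - Y i))" by (rule card_UN_le[OF assms(2)])
  finally have "real (card (X - (\<Inter>i\<in>I. Y i))) \<le> (\<Sum>i\<in>I. real (card (X - Y i)))"
    by (simp flip: of_nat_sum)
  thus ?thesis by (simp add: card_Diff)
qed

locale small_character_sums =
  fixes A :: "'a::{field,finite} set" and C :: real
  assumes zero_notin: "0 \<notin> A"
    and norm_char_sum_le: "\<And>\<psi>. mult_char \<psi> \<Longrightarrow> nontrivial \<psi> \<Longrightarrow> norm (\<Sum>x\<in>A. \<psi> x) \<le> C"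
begin

definition non_powers :: "nat set \<Rightarrow> 'a set" where
  "non_powers S = {x \<in> A. \<forall>l\<in>S. \<nexists>z. x = z ^ l}"

lemma non_powers_prime_factors: "m > 0 \<Longrightarrow> non_powers (prime_factors m) = {x \<in> A. m_free m x}"
  using zero_notin by (auto simp: non_powers_def m_free_iff)

definition bias_sum :: "nat set \<Rightarrow> nat set \<Rightarrow> real" where
  "bias_sum U S = (\<Sum>x\<in>A. (\<Prod>l\<in>U. power_bias l x) * (\<Prod>l\<in>S. 1 - power_bias l x))"

lemma norm_sum_prod_char_powers_le:
  assumes U: "finite U" "U \<noteq> {}" "\<And>l. l \<in> U \<Longrightarrow> prime l"
    and \<psi>: "\<And>l. l \<in> U \<Longrightarrow> mult_char (\<psi> l)" "\<And>l. l \<in> U \<Longrightarrow> char_has_order (\<psi> l) l"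
    and f: "f \<in> (\<Pi>\<^sub>E l\<in>U. {1..<l})"
  shows "norm (\<Sum>x\<in>A. \<Prod>l\<in>U. \<psi> l x ^ f l) \<le> C"
proof (rule norm_char_sum_le)
  have exponent: "0 < f l" "\<not> l dvd f l" if "l \<in> U" for l
    using f that by (auto dest!: PiE_mem dvd_imp_le)
  show "mult_char (\<lambda>x. \<Prod>l\<in>U. \<psi> l x ^ f l)"
    using U \<psi>(1) exponent(1) by (intro mult_char_prod mult_char_power) auto
  obtain l where "l \<in> U" using U(2) by blast
  thus "nontrivial (\<lambda>x. \<Prod>l\<in>U. \<psi> l x ^ f l)"
    using U \<psi>(2) exponent(2) by (intro nontrivial_prod_of_distinct_prime_orders)
qed

lemma abs_bias_sum_empty_le:
  assumes U: "U \<subseteq> prime_factors (CARD('a) - 1)" "U \<noteq> {}"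
  shows "\<bar>bias_sum U {}\<bar> \<le> C"
proof -
  have fin: "finite U" using U(1) by (rule finite_subset) simp
  have prime: "prime l" and "l dvd CARD('a) - 1" if "l \<in> U" for l using U that by auto
  hence "\<forall>l\<in>U. \<exists>\<psi>::'a \<Rightarrow> complex. mult_char \<psi> \<and> char_has_order \<psi> l"
    using mult_char_with_order_exists by blast
  then obtain \<psi> :: "nat \<Rightarrow> 'a \<Rightarrow> complex"
    where \<psi>: "\<And>l. l \<in> U \<Longrightarrow> mult_char (\<psi> l)" "\<And>l. l \<in> U \<Longrightarrow> char_has_order (\<psi> l) l"
    by metis
  define E where "E = (\<Pi>\<^sub>E l\<in>U. {1..<l})"
  have "card E > 0" unfolding E_def using fin prime prime_gt_1_nat
    by (auto simp: card_PiE intro!: prod_pos)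
  have "power_bias l x = (\<Sum>j\<in>{1..<l}. \<psi> l x ^ j) / of_nat (card {1..<l})"
    if "x \<in> A" "l \<in> U" for x l
    using that zero_notin \<psi> prime
    by (subst power_bias_eq_mean_of_char_powers[of "\<psi> l"])
      (auto intro: prime_gt_1_nat simp flip: One_nat_def)
  hence "complex_of_real (bias_sum U {})
      = (\<Sum>x\<in>A. \<Prod>l\<in>U. (\<Sum>j\<in>{1..<l}. \<psi> l x ^ j) / of_nat (card {1..<l}))"
    by (simp add: bias_sum_def)
  also have "\<dots> = (\<Sum>x\<in>A. \<Sum>f\<in>E. \<Prod>l\<in>U. \<psi> l x ^ f l) / of_nat (card E)"
    unfolding prod_mean_eq_mean_prod[OF fin finite_atLeastLessThan] E_def
    by (rule sum_divide_distrib[symmetric])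
  also have "(\<Sum>x\<in>A. \<Sum>f\<in>E. \<Prod>l\<in>U. \<psi> l x ^ f l) = (\<Sum>f\<in>E. \<Sum>x\<in>A. \<Prod>l\<in>U. \<psi> l x ^ f l)"
    by (rule sum.swap)
  finally have "norm (complex_of_real (bias_sum U {}))
      = norm ((\<Sum>f\<in>E. \<Sum>x\<in>A. \<Prod>l\<in>U. \<psi> l x ^ f l) / of_nat (card E))"
    by (rule arg_cong)
  hence "\<bar>bias_sum U {}\<bar> = norm (\<Sum>f\<in>E. \<Sum>x\<in>A. \<Prod>l\<in>U. \<psi> l x ^ f l) / card E"
    by (simp only: norm_divide norm_of_real norm_of_nat)
  also have "norm (\<Sum>f\<in>E. \<Sum>x\<in>A. \<Prod>l\<in>U. \<psi> l x ^ f l) \<le> (\<Sum>f\<in>E. C)"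
    unfolding E_def by (intro sum_norm_le norm_sum_prod_char_powers_le fin U(2) prime \<psi>)
  finally show ?thesis using \<open>card E > 0\<close> by (simp add: divide_right_mono)
qed

lemma bias_sum_insert:
  assumes "finite S" "l \<notin> S" "finite U" "l \<notin> U"
  shows "bias_sum U (insert l S) = bias_sum U S - bias_sum (insert l U) S"
  using assms by (simp add: bias_sum_def algebra_simps sum_subtractf)

lemma abs_bias_sum_le:
  assumes "S \<subseteq> prime_factors (CARD('a) - 1)" "U \<subseteq> prime_factors (CARD('a) - 1)"
    and "U \<noteq> {}" "U \<inter> S = {}"
  shows "\<bar>bias_sum U S\<bar> \<le> 2 ^ card S * C"
proof -
  have "finite S" using assms(1) by (rule finite_subset) simp
  thus ?thesis using assms
  proof (induction S arbitrary: U)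
    case empty
    thus ?case using abs_bias_sum_empty_le by simp
  next
    case (insert l S)
    have "finite U" using insert.prems(2) by (rule finite_subset) simp
    hence "bias_sum U (insert l S) = bias_sum U S - bias_sum (insert l U) S"
      using insert by (intro bias_sum_insert) auto
    moreover have "\<bar>bias_sum U S\<bar> \<le> 2 ^ card S * C" "\<bar>bias_sum (insert l U) S\<bar> \<le> 2 ^ card S * C"
      using insert.hyps insert.prems by (intro insert.IH; blast)+
    ultimately show ?case using insert.hyps by simp
  qed
qed

lemma abs_bias_sum_insert_diff_le:
  assumes "S \<subseteq> prime_factors (CARD('a) - 1)" "l \<in> prime_factors (CARD('a) - 1)" "l \<notin> S"
  shows "\<bar>bias_sum {} (insert l S) - bias_sum {} S\<bar> \<le> 2 ^ card S * C"
proof -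
  have "finite S" using assms(1) by (rule finite_subset) simp
  thus ?thesis using assms abs_bias_sum_le[of S "{l}"] by (simp add: bias_sum_insert)
qed

lemma abs_bias_sum_minus_card_le:
  assumes "S \<subseteq> prime_factors (CARD('a) - 1)"
  shows "\<bar>bias_sum {} S - card A\<bar> \<le> (2 ^ card S - 1) * C"
proof -
  have "finite S" using assms by (rule finite_subset) simp
  thus ?thesis using assms
  proof (induction S)
    case empty
    thus ?case by (simp add: bias_sum_def)
  next
    case (insert l S)
    have "\<bar>bias_sum {} (insert l S) - bias_sum {} S\<bar> \<le> 2 ^ card S * C"
      using insert by (intro abs_bias_sum_insert_diff_le) auto
    moreover have "\<bar>bias_sum {} S - card A\<bar> \<le> (2 ^ card S - 1) * C" using insert by simp
    ultimately show ?case using insert.hyps by (simp add: algebra_simps)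
  qed
qed

lemma card_non_powers:
  assumes "S \<subseteq> prime_factors (CARD('a) - 1)"
  shows "real (card (non_powers S)) = (\<Prod>l\<in>S. 1 - 1 / real l) * bias_sum {} S"
proof -
  have fin: "finite S" using assms by (rule finite_subset) simp
  have "(\<Prod>l\<in>S. 1 - 1 / real l) * bias_sum {} S
      = (\<Sum>x\<in>A. \<Prod>l\<in>S. (1 - 1 / real l) * (1 - power_bias l x))"
    by (simp add: bias_sum_def sum_distrib_left prod.distrib)
  also have "\<dots> = (\<Sum>x\<in>A. \<Prod>l\<in>S. of_bool (\<nexists>z. x = z ^ l))"
    using assms by (intro sum.cong prod.cong refl one_minus_power_bias prime_gt_1_nat) auto
  also have "\<dots> = (\<Sum>x\<in>A. of_bool (\<forall>l\<in>S. \<nexists>z. x = z ^ l))"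
    using fin by (intro sum.cong refl, induction S) auto
  also have "\<dots> = real (card (non_powers S))"
    by (simp add: non_powers_def Int_def)
  finally show ?thesis ..
qed

lemma card_non_powers_Un_ge:
  assumes "finite P"
  shows "real (card (non_powers (S \<union> P))) \<ge> real (card (non_powers S))
    - (\<Sum>l\<in>P. real (card (non_powers S)) - real (card (non_powers (insert l S))))"
proof -
  have "non_powers (S \<union> P) = non_powers S \<inter> (\<Inter>l\<in>P. {x. \<nexists>z. x = z ^ l})"
    and "non_powers (insert l S) = non_powers S \<inter> {x. \<nexists>z. x = z ^ l}" for l
    by (auto simp: non_powers_def)
  thus ?thesis using card_Int_INT_ge[OF _ assms, of "non_powers S"] by simp
qed

lemma card_non_powers_diff_insert_le:
  assumes "S \<subseteq> prime_factors (CARD('a) - 1)" and l: "l \<in> prime_factors (CARD('a) - 1)" "l \<notin> S"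
  shows "real (card (non_powers S)) - real (card (non_powers (insert l S)))
    \<le> (\<Prod>l\<in>S. 1 - 1 / real l) * (bias_sum {} S / l + (1 - 1 / real l) * (2 ^ card S * C))"
proof -
  let ?t = "\<Prod>l\<in>S. 1 - 1 / real l"
  have fin: "finite S" using assms(1) by (rule finite_subset) simp
  have "l > 0" using l(1) by (auto intro: prime_gt_0_nat)
  have "bias_sum {} S - bias_sum {} (insert l S) \<le> 2 ^ card S * C"
    using abs_bias_sum_insert_diff_le[OF assms] by simp
  hence "(1 - 1 / real l) * (bias_sum {} S - bias_sum {} (insert l S))
      \<le> (1 - 1 / real l) * (2 ^ card S * C)"
    using \<open>l > 0\<close> by (intro mult_left_mono) (simp_all add: field_simps)
  hence "?t * (bias_sum {} S - (1 - 1 / real l) * bias_sum {} (insert l S))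
      \<le> ?t * (bias_sum {} S / l + (1 - 1 / real l) * (2 ^ card S * C))"
    by (intro mult_left_mono prod_one_minus_inverse_primes_nonneg[OF assms(1)])
      (simp add: algebra_simps)
  moreover have "real (card (non_powers (insert l S)))
      = ?t * ((1 - 1 / real l) * bias_sum {} (insert l S))"
    using assms fin by (simp add: card_non_powers)
  ultimately show ?thesis
    by (simp only: card_non_powers[OF assms(1)] right_diff_distrib)
qed

theorem card_non_powers_Un_sieve_ge:
  assumes S: "S \<subseteq> prime_factors (CARD('a) - 1)" and P: "P \<subseteq> prime_factors (CARD('a) - 1)"
    and "S \<inter> P = {}" and D: "D = 1 - (\<Sum>l\<in>P. 1 / real l)" "D \<ge> 0"
  shows "real (card (non_powers (S \<union> P))) \<ge> (\<Prod>l\<in>S. 1 - 1 / real l) *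
    (D * (card A + C) - (real (card P) - 1 + 2 * D) * (2 ^ card S * C))"
proof -
  define t where "t = (\<Prod>l\<in>S. 1 - 1 / real l)"
  define E where "E = 2 ^ card S * C"
  have "finite P" using P by (rule finite_subset) simp
  have "(\<Sum>l\<in>P. real (card (non_powers S)) - real (card (non_powers (insert l S))))
      \<le> (\<Sum>l\<in>P. t * (bias_sum {} S / l + (1 - 1 / real l) * E))"
    unfolding t_def E_def using assms by (intro sum_mono card_non_powers_diff_insert_le) auto
  also have "\<dots> = t * (bias_sum {} S * (\<Sum>l\<in>P. 1 / real l) + (\<Sum>l\<in>P. 1 - 1 / real l) * E)"
    by (simp add: sum.distrib sum_distrib_left sum_distrib_right sum_subtractf algebra_simps)
  also have "\<dots> = t * (bias_sum {} S * (1 - D) + (real (card P) - 1 + D) * E)"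
    by (simp add: D(1) sum_subtractf)
  finally have "real (card (non_powers (S \<union> P)))
      \<ge> t * bias_sum {} S - t * (bias_sum {} S * (1 - D) + (real (card P) - 1 + D) * E)"
    using card_non_powers_Un_ge[OF \<open>finite P\<close>, of S] card_non_powers[OF S] by (simp add: t_def)
  moreover have "t * (D * (card A + C) - (real (card P) - 1 + 2 * D) * E)
      \<le> t * (D * bias_sum {} S - (real (card P) - 1 + D) * E)"
  proof -
    have "card A + C - E \<le> bias_sum {} S"
      using abs_bias_sum_minus_card_le[OF S] by (simp add: E_def algebra_simps)
    hence "D * (card A + C - E) \<le> D * bias_sum {} S" using D(2) by (rule mult_left_mono)
    thus ?thesis unfolding t_def
      by (intro mult_left_mono prod_one_minus_inverse_primes_nonneg[OF S]) (simp add: algebra_simps)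
  qed
  ultimately show ?thesis unfolding t_def E_def by (simp add: algebra_simps)
qed

end

section \<open>Character sums over the fibres of a linear functional\<close>

locale subfield_functional =
  fixes F :: "'a::{field,finite} set" and L :: "'a \<Rightarrow> 'a"
  assumes subfield: "is_subfield F"
    and L_add: "L (x + y) = L x + L y"
    and L_scale: "c \<in> F \<Longrightarrow> L (c * x) = c * L x"
    and L_in_subfield: "L x \<in> F"
    and L_nonzero: "\<exists>x. L x \<noteq> 0"
begin

lemma subfield_closed:
  "0 \<in> F" "1 \<in> F" "x \<in> F \<Longrightarrow> y \<in> F \<Longrightarrow> x * y \<in> F" "x \<in> F \<Longrightarrow> inverse x \<in> F"
  using subfield by (auto simp: is_subfield_def)

lemma L_zero: "L 0 = 0"
  using L_scale[of 0 0] by (simp add: subfield_closed)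

lemma L_diff: "L (x - y) = L x - L y"
  using L_add[of "x - y" y] by simp

definition fibre_size :: real where
  "fibre_size = real CARD('a) / real (card F)"

lemma card_subfield_mult_fibre_size: "real (card F) * fibre_size = real CARD('a)"
proof -
  have "F \<noteq> {}" using subfield_closed(1) by blast
  thus ?thesis by (simp add: fibre_size_def)
qed

lemma card_fibre:
  assumes "b \<in> F"
  shows "real (card {x. L x = b}) = fibre_size"
proof -
  have eq_kernel: "card {x. L x = c} = card {x. L x = 0}" if "c \<in> F" for c
  proof -
    obtain u where "L u \<noteq> 0" using L_nonzero by blast
    define z where "z = c * inverse (L u) * u"
    have "L z = c" unfolding z_def
      using that \<open>L u \<noteq> 0\<close> by (simp add: L_scale subfield_closed L_in_subfield)
    hence "bij_betw (\<lambda>x. x - z) {x. L x = c} {x. L x = 0}"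
      by (intro bij_betw_byWitness[of _ "\<lambda>x. x + z"]) (auto simp: L_add L_diff)
    thus ?thesis by (rule bij_betw_same_card)
  qed
  have "CARD('a) = (\<Sum>x\<in>(UNIV::'a set). 1)" by simp
  also have "\<dots> = (\<Sum>c\<in>F. card {x. L x = c})"
    using sum_fun_comp[of UNIV F L "\<lambda>_. 1::nat"] L_in_subfield by auto
  also have "\<dots> = card F * card {x. L x = b}"
    by (simp add: eq_kernel assms)
  finally have "real CARD('a) = real (card F) * real (card {x. L x = b})"
    by (simp only: of_nat_mult)
  thus ?thesis using subfield_closed(1) by (auto simp flip: card_subfield_mult_fibre_size)
qed

lemma fibre_size_pos: "fibre_size > 0"
  using one_less_card_subfield[OF subfield] by (simp add: fibre_size_def)

definition fibre_sum :: "'a \<Rightarrow> ('a \<Rightarrow> complex) \<Rightarrow> complex" where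
  "fibre_sum b f = (\<Sum>x | L x = b. f x)"

lemma fibre_sum_scale:
  assumes "mult_char \<psi>" "c \<in> F" "c \<noteq> 0"
  shows "fibre_sum (c * b) \<psi> = \<psi> c * fibre_sum b \<psi>"
proof -
  have "fibre_sum (c * b) \<psi> = (\<Sum>x | L x = b. \<psi> (c * x))"
    unfolding fibre_sum_def
  proof (rule sum.reindex_bij_witness[of _ "\<lambda>x. c * x" "\<lambda>x. inverse c * x"])
    fix x assume "x \<in> {x. L x = c * b}"
    thus "inverse c * x \<in> {x. L x = b}"
      using assms by (auto simp: L_scale subfield_closed)
  qed (use assms in \<open>auto simp: L_scale mult.assoc[symmetric]\<close>)
  thus ?thesis by (simp add: mult_charD[OF assms(1)] fibre_sum_def sum_distrib_left)
qed

lemma sum_norm_fibre_sum_sq: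
  "complex_of_real (\<Sum>b\<in>F. (norm (fibre_sum b f))\<^sup>2)
    = (\<Sum>y\<in>UNIV. \<Sum>x | L x = L y. f x * cnj (f y))"
proof -
  have "complex_of_real (\<Sum>b\<in>F. (norm (fibre_sum b f))\<^sup>2)
      = (\<Sum>b\<in>F. fibre_sum b f * cnj (fibre_sum b f))"
    by (simp only: of_real_sum complex_norm_square)
  also have "\<dots> = (\<Sum>b\<in>F. \<Sum>y | L y = b. \<Sum>x | L x = b. f x * cnj (f y))"
    by (simp add: fibre_sum_def sum_product) (subst sum.swap, rule refl)
  also have "\<dots> = (\<Sum>b\<in>F. \<Sum>y | y \<in> UNIV \<and> L y = b. \<Sum>x | L x = L y. f x * cnj (f y))"
    by (intro sum.cong refl) auto
  also have "\<dots> = (\<Sum>y\<in>UNIV. \<Sum>x | L x = L y. f x * cnj (f y))"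
    by (rule sum.group) (auto simp: L_in_subfield)
  finally show ?thesis .
qed

lemma card_nonzero_equal_value:
  "real (card {y. y \<noteq> 0 \<and> L (t * y) = L y}) = (if t = 1 then real CARD('a) else fibre_size) - 1"
proof -
  have "0 \<in> {y. L (t * y) = L y}" by (simp add: L_zero)
  moreover have "{y. y \<noteq> 0 \<and> L (t * y) = L y} = {y. L (t * y) = L y} - {0}" by auto
  ultimately have "real (card {y. y \<noteq> 0 \<and> L (t * y) = L y}) = real (card {y. L (t * y) = L y}) - 1"
    using card_Suc_Diff1[of "{y. L (t * y) = L y}" 0] by simp
  moreover have "real (card {y. L (t * y) = L y}) = fibre_size" if "t \<noteq> 1"
  proof -
    have "{y. L (t * y) = L y} = {y. L ((t - 1) * y) = 0}"
      by (simp add: left_diff_distrib L_diff)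
    moreover have "bij_betw (\<lambda>y. (t - 1) * y) {y. L ((t - 1) * y) = 0} {x. L x = 0}"
      by (rule bij_betw_byWitness[of _ "\<lambda>y. y / (t - 1)"]) (use that in auto)
    ultimately show ?thesis using card_fibre[of 0] subfield_closed by (simp add: bij_betw_same_card)
  qed
  ultimately show ?thesis by simp
qed

lemma sum_norm_fibre_sum_sq_mult_char:
  assumes \<psi>: "mult_char \<psi>" "nontrivial \<psi>"
  shows "(\<Sum>b\<in>F. (norm (fibre_sum b \<psi>))\<^sup>2) = real CARD('a) - fibre_size"
proof -
  let ?M = "\<lambda>t. {y. y \<noteq> 0 \<and> L (t * y) = L y}"
  have fibre: "(\<Sum>x | L x = L y. \<psi> x * cnj (\<psi> y)) = (\<Sum>t | y \<in> ?M t. \<psi> t)" for y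
  proof (cases "y = 0")
    case False
    show ?thesis
      by (rule sum.reindex_bij_witness[of _ "\<lambda>t. t * y" "\<lambda>x. x / y"])
        (use False in \<open>auto simp: mult_char_divide[OF \<psi>(1)]\<close>)
  qed (simp add: mult_charD[OF \<psi>(1)])
  have "complex_of_real (\<Sum>b\<in>F. (norm (fibre_sum b \<psi>))\<^sup>2) = (\<Sum>y\<in>UNIV. \<Sum>t | y \<in> ?M t. \<psi> t)"
    by (simp only: sum_norm_fibre_sum_sq fibre)
  also have "\<dots> = (\<Sum>t\<in>UNIV. \<Sum>y\<in>?M t. \<psi> t)"
    using sum.swap_restrict[of UNIV UNIV "\<lambda>y t. \<psi> t" "\<lambda>y t. y \<in> ?M t"] by simp
  also have "\<dots> = (\<Sum>t\<in>UNIV. of_real (real (card (?M t))) * \<psi> t)" by simp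
  also have "\<dots> = (\<Sum>t\<in>UNIV. of_real (fibre_size - 1) * \<psi> t
      + (if t = 1 then of_real (CARD('a) - fibre_size) else 0))"
    unfolding card_nonzero_equal_value
    by (intro sum.cong refl) (auto simp: mult_charD[OF \<psi>(1)] algebra_simps)
  also have "\<dots> = of_real (CARD('a) - fibre_size)"
    by (simp add: sum.distrib sum_distrib_left[symmetric] sum_mult_char_nontrivial[OF \<psi>])
  finally show ?thesis by (simp only: of_real_eq_iff)
qed

lemma norm_fibre_sum_le:
  assumes \<psi>: "mult_char \<psi>" "nontrivial \<psi>" and b: "b \<in> F" "b \<noteq> 0"
  shows "norm (fibre_sum b \<psi>) \<le> sqrt fibre_size"
proof -
  have norm_constant: "norm (fibre_sum c \<psi>) = norm (fibre_sum b \<psi>)" if c: "c \<in> F - {0}" for c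
  proof -
    define a where "a = c * inverse b"
    have "a \<in> F" "a \<noteq> 0" "c = a * b" using b c by (simp_all add: a_def subfield_closed)
    thus ?thesis by (simp add: fibre_sum_scale \<psi>(1) norm_mult norm_mult_char)
  qed
  have card_F_gt_1: "card F > 1" by (rule one_less_card_subfield[OF subfield])
  hence "(real (card F) - 1) * (norm (fibre_sum b \<psi>))\<^sup>2 = (\<Sum>c\<in>F-{0}. (norm (fibre_sum c \<psi>))\<^sup>2)"
    by (simp add: norm_constant card_Diff_singleton subfield_closed of_nat_diff)
  also have "\<dots> \<le> (\<Sum>c\<in>F. (norm (fibre_sum c \<psi>))\<^sup>2)"
    by (intro sum_mono2) auto
  also have "\<dots> = (real (card F) - 1) * fibre_size"
    unfolding sum_norm_fibre_sum_sq_mult_char[OF \<psi>]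
    by (simp add: left_diff_distrib card_subfield_mult_fibre_size)
  finally have "(norm (fibre_sum b \<psi>))\<^sup>2 \<le> fibre_size" using card_F_gt_1 by simp
  thus ?thesis by (rule real_le_rsqrt)
qed

end

section \<open>Character sums over the preimages of the fibres under squaring\<close>

lemma eq_uminus_iff_if_odd_card:
  fixes x :: "'a::{field,finite}"
  assumes "odd CARD('a)"
  shows "x = - x \<longleftrightarrow> x = 0"
proof
  assume "x = - x"
  have "of_nat 2 * x = x + x" by (simp only: of_nat_numeral mult_2)
  also have "\<dots> = 0" using \<open>x = - x\<close> by (simp only: eq_neg_iff_add_eq_0)
  finally have "of_nat 2 * x = 0" .
  moreover have "of_nat 2 \<noteq> (0::'a)"
  proof
    assume "of_nat 2 = (0::'a)"
    hence "CHAR('a) dvd 2" by (simp only: of_nat_eq_0_iff_char_dvd)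
    hence "CHAR('a) = 2"
      using prime_CHAR_finite_field two_is_prime_nat by (rule primes_dvd_imp_eq[rotated 2])
    thus False using assms CHAR_dvd_CARD[where ?'a = 'a] by simp
  qed
  ultimately show "x = 0" by simp
qed simp

lemma card_square_roots:
  fixes \<rho> :: "'a::{field,finite} \<Rightarrow> complex"
  assumes "odd CARD('a)" and \<rho>: "mult_char \<rho>" "char_has_order \<rho> 2" and "y \<noteq> 0"
  shows "of_nat (card {x. x\<^sup>2 = y}) = 1 + \<rho> y"
proof (cases "\<rho> y = 1")
  case True
  then obtain z where z: "y = z\<^sup>2" using mult_char_eq_1_iff_power[OF \<rho> \<open>y \<noteq> 0\<close>] by blast
  hence "{x. x\<^sup>2 = y} = {z, - z}" by (auto simp: power2_eq_iff)
  moreover have "z \<noteq> - z" using z \<open>y \<noteq> 0\<close> eq_uminus_iff_if_odd_card[OF assms(1)] by auto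
  ultimately have "card {x. x\<^sup>2 = y} = 2" by simp
  thus ?thesis by (simp add: True)
next
  case False
  hence "{x. x\<^sup>2 = y} = {}" using mult_char_eq_1_iff_power[OF \<rho> \<open>y \<noteq> 0\<close>] by auto
  moreover have "(\<rho> y)\<^sup>2 = 1" by (rule char_has_order_power_eq_1[OF \<rho>(2) \<open>y \<noteq> 0\<close>])
  hence "\<rho> y = - 1" using False by (simp add: power2_eq_1_iff)
  ultimately show ?thesis by simp
qed

locale odd_subfield_functional = subfield_functional +
  assumes odd_card: "odd CARD('a)"
begin

lemma quadratic_char_exists:
  "\<exists>\<rho>::'a \<Rightarrow> complex. mult_char \<rho> \<and> char_has_order \<rho> 2"
  using odd_card by (intro mult_char_with_order_exists) simp

definition square_fibre :: "'a \<Rightarrow> 'a set" where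
  "square_fibre b = {x. L (x\<^sup>2) = b}"

lemma sum_square_fibre:
  assumes \<rho>: "mult_char \<rho>" "char_has_order \<rho> 2" and "b \<noteq> 0"
  shows "(\<Sum>x\<in>square_fibre b. f (x\<^sup>2)) = fibre_sum b f + fibre_sum b (\<lambda>y. \<rho> y * f y)"
proof -
  have "(\<Sum>x\<in>square_fibre b. f (x\<^sup>2))
      = (\<Sum>y | L y = b. of_nat (card {x \<in> square_fibre b. x\<^sup>2 = y}) * f y)"
    by (rule sum_fun_comp) (auto simp: square_fibre_def)
  also have "\<dots> = (\<Sum>y | L y = b. f y + \<rho> y * f y)"
  proof (intro sum.cong refl)
    fix y assume y: "y \<in> {y. L y = b}"
    hence "{x \<in> square_fibre b. x\<^sup>2 = y} = {x. x\<^sup>2 = y}" by (auto simp: square_fibre_def)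
    moreover have "y \<noteq> 0" using y \<open>b \<noteq> 0\<close> L_zero by auto
    ultimately show "of_nat (card {x \<in> square_fibre b. x\<^sup>2 = y}) * f y = f y + \<rho> y * f y"
      by (simp add: card_square_roots[OF odd_card \<rho>] algebra_simps)
  qed
  finally show ?thesis by (simp add: fibre_sum_def sum.distrib)
qed

lemma sum_square_fibre_odd_char:
  assumes \<psi>: "mult_char \<psi>" and "\<psi> (- 1) \<noteq> 1"
  shows "(\<Sum>x\<in>square_fibre b. \<psi> x) = 0"
proof -
  have "(\<Sum>x\<in>square_fibre b. \<psi> x) = (\<Sum>x\<in>square_fibre b. \<psi> (- 1 * x))"
    by (rule sum.reindex_bij_witness[of _ uminus uminus]) (auto simp: square_fibre_def)
  also have "\<dots> = \<psi> (- 1) * (\<Sum>x\<in>square_fibre b. \<psi> x)"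
    by (simp only: mult_charD[OF \<psi>] sum_distrib_left)
  finally show ?thesis using assms(2) by simp
qed

lemma norm_sum_square_fibre_le:
  assumes \<psi>: "mult_char \<psi>" "nontrivial \<psi>" and b: "b \<in> F" "b \<noteq> 0"
  shows "norm (\<Sum>x\<in>square_fibre b. \<psi> x) \<le> 2 * sqrt fibre_size"
proof (cases "\<psi> (- 1) = 1")
  case True
  hence "\<psi> z = 1" if "z\<^sup>2 = 1" for z
    using that mult_charD(2)[OF \<psi>(1)] by (auto simp: power2_eq_1_iff)
  then obtain \<eta> where \<eta>: "mult_char \<eta>" and \<psi>_eq: "\<psi> = (\<lambda>x. (\<eta> x)\<^sup>2)"
    using mult_char_root_exists[OF \<psi>(1), of 2] odd_card by auto
  obtain \<rho> :: "'a \<Rightarrow> complex" where \<rho>: "mult_char \<rho>" "char_has_order \<rho> 2"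
    using quadratic_char_exists by blast
  obtain x where x: "x \<noteq> 0" "(\<eta> x)\<^sup>2 \<noteq> 1" using \<psi>(2) by (auto simp: nontrivial_def \<psi>_eq)
  have "(\<rho> x * \<eta> x)\<^sup>2 = (\<eta> x)\<^sup>2"
    using char_has_order_power_eq_1[OF \<rho>(2) x(1)] by (simp add: power_mult_distrib)
  hence "\<eta> x \<noteq> 1" "\<rho> x * \<eta> x \<noteq> 1" using x(2) by auto
  hence nontriv: "nontrivial \<eta>" "nontrivial (\<lambda>x. \<rho> x * \<eta> x)"
    using x(1) unfolding nontrivial_def by blast+
  have "(\<Sum>x\<in>square_fibre b. \<psi> x) = fibre_sum b \<eta> + fibre_sum b (\<lambda>x. \<rho> x * \<eta> x)"
    using sum_square_fibre[OF \<rho> b(2), of \<eta>] by (simp add: \<psi>_eq mult_char_apply_power \<eta>)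
  also have "norm \<dots> \<le> sqrt fibre_size + sqrt fibre_size"
    using nontriv b \<eta> \<rho>(1) by (intro norm_triangle_mono norm_fibre_sum_le mult_char_mult)
  finally show ?thesis by simp
qed (simp add: sum_square_fibre_odd_char \<psi> less_imp_le fibre_size_pos)

lemma abs_card_square_fibre_le:
  assumes b: "b \<in> F" "b \<noteq> 0"
  shows "\<bar>real (card (square_fibre b)) - fibre_size\<bar> \<le> sqrt fibre_size"
proof -
  obtain \<rho> :: "'a \<Rightarrow> complex" where \<rho>: "mult_char \<rho>" "char_has_order \<rho> 2"
    using quadratic_char_exists by blast
  have "of_nat (card (square_fibre b)) = of_nat (card {x. L x = b}) + fibre_sum b \<rho>"
    using sum_square_fibre[OF \<rho> b(2), of "\<lambda>_. 1"] by (simp add: fibre_sum_def)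
  hence "complex_of_real (real (card (square_fibre b)) - fibre_size) = fibre_sum b \<rho>"
    by (simp flip: card_fibre[OF b(1)])
  hence "\<bar>real (card (square_fibre b)) - fibre_size\<bar> = norm (fibre_sum b \<rho>)"
    by (metis norm_of_real)
  also have "\<dots> \<le> sqrt fibre_size"
    using \<rho> b by (intro norm_fibre_sum_le char_has_order_imp_nontrivial[of _ 2]) simp_all
  finally show ?thesis .
qed

lemma small_character_sums_square_fibre:
  assumes "b \<in> F" "b \<noteq> 0"
  shows "small_character_sums (square_fibre b) (2 * sqrt fibre_size)"
proof
  show "0 \<notin> square_fibre b" using assms(2) L_zero by (auto simp: square_fibre_def)
qed (rule norm_sum_square_fibre_le[OF _ _ assms])

end

section \<open>Free elements with prescribed trace of the square\<close>

locale trace_extension =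
  fixes F :: "'a::{field,finite} set" and q n :: nat
  assumes primepow_q: "primepow q" and n_pos: "n > 0"
    and card_UNIV: "CARD('a) = q ^ n" and is_subfield: "is_subfield F" and card_F: "card F = q"
begin

lemma q_gt_1: "q > 1"
  using primepow_gt_Suc_0[OF primepow_q] by simp

lemma q_eq_CHAR_power: "\<exists>e. q = CHAR('a) ^ e"
proof -
  obtain p e where pe: "prime p" "q = p ^ e" using primepow_q by (auto simp: primepow_def)
  have "CHAR('a) dvd p ^ (e * n)"
    using CHAR_dvd_CARD[where ?'a = 'a] by (simp add: card_UNIV pe power_mult)
  hence "CHAR('a) = p"
    using prime_CHAR_finite_field pe by (metis prime_dvd_power primes_dvd_imp_eq)
  thus ?thesis using pe by auto
qed

lemma frobenius_power_add: "(x + y) ^ (q ^ i) = x ^ (q ^ i) + (y::'a) ^ (q ^ i)"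
proof -
  obtain e where "q = CHAR('a) ^ e" using q_eq_CHAR_power by blast
  hence "q ^ i = CHAR('a) ^ (e * i)" by (simp add: power_mult)
  thus ?thesis by (rule freshmans_dream'[OF prime_CHAR_finite_field])
qed

lemma frobenius_sum: "sum f A ^ q = (\<Sum>i\<in>A. (f i :: 'a) ^ q)"
proof -
  obtain e where "q = CHAR('a) ^ e" using q_eq_CHAR_power by blast
  thus ?thesis by (intro freshmans_dream_sum'[OF prime_CHAR_finite_field])
qed

lemma mem_F_iff: "x \<in> F \<longleftrightarrow> x ^ q = x"
  using subfield_eq_fixed_points[OF is_subfield] by (auto simp: card_F)

lemma trace_scale:
  assumes "c \<in> F"
  shows "field_trace q n (c * x) = c * field_trace q n x"
proof -
  have "c ^ (q ^ i) = c" for i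
    using assms by (induction i) (auto simp: mem_F_iff power_mult)
  thus ?thesis by (simp add: field_trace_def power_mult_distrib sum_distrib_left)
qed

lemma trace_in_F: "field_trace q n (x::'a) \<in> F"
proof -
  have "field_trace q n x ^ q = (\<Sum>i<n. x ^ (q ^ Suc i))"
    by (simp add: field_trace_def frobenius_sum mult.commute flip: power_mult)
  also have "\<dots> = field_trace q n x + x ^ (q ^ n) - x"
    using sum.lessThan_Suc_shift[of "\<lambda>i. x ^ (q ^ i)" n] by (simp add: field_trace_def)
  also have "x ^ (q ^ n) = x"
    using subfield_power_card[OF is_subfield_UNIV, of x] by (simp add: card_UNIV)
  finally show ?thesis by (simp add: mem_F_iff)
qed

lemma trace_nonzero: "\<exists>x::'a. field_trace q n x \<noteq> 0"
proof (rule ccontr)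
  let ?p = "\<Sum>i<n. monom 1 (q ^ i) :: 'a poly"
  assume "\<not> ?thesis"
  hence "{x. poly ?p x = 0} = UNIV" by (auto simp: poly_sum poly_monom field_trace_def)
  moreover have "coeff ?p (q ^ (n - 1)) = (\<Sum>i<n. if i = n - 1 then 1 else 0)"
    using q_gt_1 by (auto simp: coeff_sum intro!: sum.cong)
  hence "coeff ?p (q ^ (n - 1)) = 1" using n_pos by simp
  hence "?p \<noteq> 0" by (metis coeff_0 zero_neq_one)
  ultimately have "q ^ n \<le> degree ?p" using card_poly_roots_bound[of ?p] by (simp add: card_UNIV)
  also have "degree ?p \<le> q ^ (n - 1)"
    using q_gt_1 by (intro degree_sum_le) (auto simp: degree_monom_eq intro!: power_increasing)
  also have "\<dots> < q ^ n" using q_gt_1 n_pos by (intro power_strict_increasing) auto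
  finally show False by simp
qed

sublocale subfield_functional F "field_trace q n"
proof
  show "field_trace q n (x + y) = field_trace q n x + field_trace q n y" for x y :: 'a
    by (simp add: field_trace_def frobenius_power_add sum.distrib)
qed (fact is_subfield trace_scale trace_in_F trace_nonzero)+

lemma sqrt_fibre_size: "sqrt fibre_size = real q powr ((real n - 1) / 2)"
proof -
  have "fibre_size = real q powr (real n - 1)"
    using q_gt_1 by (simp add: fibre_size_def card_UNIV card_F powr_diff powr_realpow)
  thus ?thesis by (simp add: powr_half_sqrt_powr)
qed

end

lemma prime_factors_prod_primes:
  fixes A :: "nat set"
  assumes "finite A" "\<And>l. l \<in> A \<Longrightarrow> prime l"
  shows "prime_factors (\<Prod>A) = A"
proof -
  have "0 \<notin> A" using assms(2) not_prime_0 by blast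
  thus ?thesis using assms by (subst prime_factors_prod) (auto simp: prime_prime_factors)
qed

lemma radical_factors_pos:
  fixes k m M :: nat
  assumes "k * m = \<Prod>(prime_factors M)"
  shows "k > 0" "m > 0"
proof -
  have "k * m > 0" unfolding assms by (intro prod_pos) (auto intro: prime_gt_0_nat)
  thus "k > 0" "m > 0" by simp_all
qed

lemma prime_factors_eq_Un_if_radical_eq:
  fixes k M :: nat
  assumes "k * \<Prod>P = \<Prod>(prime_factors M)" and P: "finite P" "\<And>l. l \<in> P \<Longrightarrow> prime l"
  shows "prime_factors M = prime_factors k \<union> P"
proof -
  have nonzero: "k \<noteq> 0" "\<Prod>P \<noteq> 0" using radical_factors_pos[OF assms(1)] by simp_all
  have "prime_factors M = prime_factors (k * \<Prod>P)"
    unfolding assms(1) by (rule prime_factors_prod_primes[symmetric]) auto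
  also have "\<dots> = prime_factors k \<union> P"
    by (simp only: prime_factors_product[OF nonzero] prime_factors_prod_primes[OF P])
  finally show ?thesis .
qed

lemma \<theta>_eq_prod: "m > 0 \<Longrightarrow> \<theta> m = (\<Prod>l\<in>prime_factors m. 1 - 1 / real l)"
  by (simp add: \<theta>_def totient_formula2)

lemma W_prod_subset_le:
  assumes "A \<subseteq> prime_factors k"
  shows "W (\<Prod>A) \<le> W k"
proof -
  have "finite A" using assms by (rule finite_subset) simp
  hence "prime_factors (\<Prod>A) = A" using assms by (intro prime_factors_prod_primes) auto
  hence "\<nu> (\<Prod>A) \<le> \<nu> k" using assms by (simp add: \<nu>_def card_mono)
  thus ?thesis by (simp add: W_def power_increasing)
qed

locale odd_trace_extension = trace_extension +
  assumes odd_q: "odd q"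
begin

sublocale odd_subfield_functional F "field_trace q n"
  by standard (simp add: card_UNIV odd_q)

theorem N_free_ge:
  assumes \<beta>: "\<beta> \<in> F" "\<beta> \<noteq> 0"
    and k: "k > 0" "prime_factors (q ^ n - 1) = prime_factors k \<union> P" "prime_factors k \<inter> P = {}"
    and \<delta>: "\<delta> = 1 - (\<Sum>l\<in>P. 1 / real l)" "\<delta> > 0"
  defines "Y \<equiv> real q powr ((real n - 1) / 2)"
  shows "real (N_free q n \<beta> (q ^ n - 1)) \<ge>
    \<delta> * \<theta> k * Y * (Y - 2 * ((real (card P) - 1) / \<delta> + 2) * W k)"
proof -
  have Y: "sqrt fibre_size = Y" unfolding Y_def by (rule sqrt_fibre_size)
  hence fibre_size: "fibre_size = Y\<^sup>2" using fibre_size_pos by (metis less_imp_le real_sqrt_pow2)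
  interpret small_character_sums "square_fibre \<beta>" "2 * Y"
    using small_character_sums_square_fibre[OF \<beta>] by (simp only: Y)
  have "q ^ n - 1 > 0" using one_less_power[OF q_gt_1 n_pos] by simp
  hence "non_powers (prime_factors k \<union> P) = {x \<in> square_fibre \<beta>. m_free (q ^ n - 1) x}"
    unfolding k(2)[symmetric] by (rule non_powers_prime_factors)
  hence N_free: "N_free q n \<beta> (q ^ n - 1) = card (non_powers (prime_factors k \<union> P))"
    by (simp only: N_free_def square_fibre_def mem_Collect_eq conj_commute)
  have "card (square_fibre \<beta>) + 2 * Y \<ge> Y\<^sup>2"
    using abs_card_square_fibre_le[OF \<beta>] Y fibre_size by (simp add: Y_def)
  hence "\<theta> k * (\<delta> * Y\<^sup>2 - (real (card P) - 1 + 2 * \<delta>) * (W k * (2 * Y)))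
      \<le> \<theta> k * (\<delta> * (card (square_fibre \<beta>) + 2 * Y)
          - (real (card P) - 1 + 2 * \<delta>) * (W k * (2 * Y)))"
    using \<delta>(2) by (intro mult_left_mono diff_right_mono) (auto simp: \<theta>_def)
  also have "\<dots> \<le> card (non_powers (prime_factors k \<union> P))"
    unfolding \<theta>_eq_prod[OF k(1)] W_def \<nu>_def of_nat_power of_nat_numeral
    using k \<delta> by (intro card_non_powers_Un_sieve_ge) (auto simp: card_UNIV)
  also have "\<theta> k * (\<delta> * Y\<^sup>2 - (real (card P) - 1 + 2 * \<delta>) * (W k * (2 * Y)))
      = \<delta> * \<theta> k * Y * (Y - 2 * ((real (card P) - 1) / \<delta> + 2) * W k)"
    using \<delta>(2) by (simp add: field_simps power2_eq_square)
  finally show ?thesis by (simp only: N_free)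
qed

theorem N_free_ge_indexed:
  assumes \<beta>: "\<beta> \<in> F" "\<beta> \<noteq> 0"
    and radical: "k * (\<Prod>i\<in>I. p i) = \<Prod>(prime_factors (q ^ n - 1))"
    and p: "finite I" "\<forall>i\<in>I. prime (p i) \<and> \<not> p i dvd k" "inj_on p I"
    and \<delta>: "\<delta> = 1 - (\<Sum>i\<in>I. 1 / real (p i))" "\<delta> > 0"
  defines "Y \<equiv> real q powr ((real n - 1) / 2)"
  shows "real (N_free q n \<beta> (q ^ n - 1)) \<ge>
    \<delta> * \<theta> k * Y * (Y - 2 * ((real (card I) - 1) / \<delta> + 2) * W k)"
proof -
  have "k * \<Prod>(p ` I) = \<Prod>(prime_factors (q ^ n - 1))"
    using radical by (simp add: prod.reindex[OF p(3)])
  hence factors: "prime_factors (q ^ n - 1) = prime_factors k \<union> p ` I"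
    using p(1,2) by (intro prime_factors_eq_Un_if_radical_eq) auto
  have k_pos: "k > 0" by (rule radical_factors_pos[OF radical])
  have disjoint: "prime_factors k \<inter> p ` I = {}" using p(2) by auto
  have \<delta>_image: "\<delta> = 1 - (\<Sum>l\<in>p ` I. 1 / real l)" using \<delta>(1) by (simp add: sum.reindex[OF p(3)])
  show ?thesis
    using N_free_ge[OF \<beta> k_pos factors disjoint \<delta>_image \<delta>(2)]
    by (simp only: Y_def card_image[OF p(3)])
qed

end

lemma sieve_coefficient_mono:
  fixes p :: "nat \<Rightarrow> nat"
  assumes "r \<le> s" "\<And>i. i \<in> {1..s} \<Longrightarrow> p i > 0" "\<delta> > 0"
    and \<delta>: "\<delta> = 1 - (\<Sum>i=1..s. 1 / real (p i))" "\<delta>Q = 1 - (\<Sum>i=1..r. 1 / real (p i))"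
  shows "0 \<le> (real r - 1 + \<delta>Q) / \<delta> + 1"
    and "(real r - 1 + \<delta>Q) / \<delta> + 1 \<le> (real s - 1) / \<delta> + 2"
proof -
  have terms_nonneg: "0 \<le> 1 - 1 / real (p i)" if "i \<in> {1..s}" for i
    using assms(2)[OF that] by simp
  have r: "real r - 1 + \<delta>Q = (\<Sum>i=1..r. 1 - 1 / real (p i))"
    and s: "real s - 1 + \<delta> = (\<Sum>i=1..s. 1 - 1 / real (p i))" by (simp_all add: \<delta> sum_subtractf)
  have "0 \<le> real r - 1 + \<delta>Q" unfolding r using terms_nonneg assms(1) by (intro sum_nonneg) auto
  thus "0 \<le> (real r - 1 + \<delta>Q) / \<delta> + 1" using assms(3) by simp
  have "(real r - 1 + \<delta>Q) / \<delta> \<le> (real s - 1 + \<delta>) / \<delta>"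
    unfolding r s using terms_nonneg assms(1,3) by (intro divide_right_mono sum_mono2) auto
  also have "\<dots> = (real s - 1) / \<delta> + 1" using assms(3) by (simp add: add_divide_distrib)
  finally show "(real r - 1 + \<delta>Q) / \<delta> + 1 \<le> (real s - 1) / \<delta> + 2" by simp
qed

theorem theorem6p2:
  fixes F :: "'a::{field,finite} set" and \<beta> :: 'a
    and q n Q k kQ r s :: nat and p :: "nat \<Rightarrow> nat" and \<delta> \<delta>Q :: real
  assumes "primepow q" and "odd q" and "prime n" and "even ((q ^ n - 1) div 2)"
    and "CARD('a) = q ^ n" and "is_subfield F" and "card F = q"
    and "\<beta> \<in> F" and "\<beta> \<noteq> 0"
    and "Q = (q ^ n - 1) div (q - 1)"
    and "k * (\<Prod>i=1..s. p i) = \<Prod>(prime_factors (q ^ n - 1))"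
    and "\<forall>i\<in>{1..s}. prime (p i) \<and> \<not> p i dvd k" and "inj_on p {1..s}"
    and "r \<le> s" and "\<forall>i\<in>{1..r}. p i dvd Q" and "\<forall>i\<in>{r<..s}. \<not> p i dvd Q"
    and "\<delta> = 1 - (\<Sum>i=1..s. 1 / real (p i))"
    and "\<delta>Q = 1 - (\<Sum>i=1..r. 1 / real (p i))"
    and "kQ = \<Prod>{l \<in> prime_factors k. l dvd Q}"
    and "\<delta> > 0"
  shows "real (N_free q n \<beta> (q ^ n - 1)) \<ge>
      \<delta> * \<theta> k * real q powr ((real n - 1) / 2) *
        (real q powr ((real n - 1) / 2)
          - 4 * ((real s - 1) / \<delta> + 2) * real (W k)
          + 2 * ((real r - 1 + \<delta>Q) / \<delta> + 1) * real (W kQ))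
    \<and> (real q powr ((real n - 1) / 2) >
          4 * ((real s - 1) / \<delta> + 2) * real (W k)
          - 2 * ((real r - 1 + \<delta>Q) / \<delta> + 1) * real (W kQ)
        \<longrightarrow> N_free q n \<beta> (q ^ n - 1) > 0)"
proof -
  interpret odd_trace_extension F q n
    using assms(1,2,5-7) prime_gt_0_nat[OF assms(3)] by unfold_locales
  define Y where "Y = real q powr ((real n - 1) / 2)"
  define u where "u = (real s - 1) / \<delta> + 2"
  define v where "v = (real r - 1 + \<delta>Q) / \<delta> + 1"
  have sieve: "\<delta> * \<theta> k * Y * (Y - 2 * u * W k) \<le> N_free q n \<beta> (q ^ n - 1)"
    using N_free_ge_indexed[OF assms(8,9,11) _ assms(12,13,17,20)] by (simp add: Y_def u_def)
  have "k > 0" by (rule radical_factors_pos[OF assms(11)])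
  hence "\<theta> k > 0" "Y > 0" using q_gt_1 by (simp_all add: \<theta>_def Y_def)
  hence scale_pos: "\<delta> * \<theta> k * Y > 0" using assms(20) by simp
  have "W kQ \<le> W k" unfolding assms(19) by (rule W_prod_subset_le) auto
  moreover have "0 \<le> v" "v \<le> u" unfolding u_def v_def
    using sieve_coefficient_mono[OF assms(14) _ assms(20,17,18)] assms(12)
    by (auto simp: prime_gt_0_nat)
  ultimately have "v * W kQ \<le> u * W k" by (intro mult_mono) auto
  hence "\<delta> * \<theta> k * Y * (Y - 4 * u * W k + 2 * v * W kQ) \<le> \<delta> * \<theta> k * Y * (Y - 2 * u * W k)"
    using scale_pos by (intro mult_left_mono) auto
  also note sieve
  finally have main: "\<delta> * \<theta> k * Y * (Y - 4 * u * W k + 2 * v * W kQ) \<le> N_free q n \<beta> (q ^ n - 1)" .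
  moreover have "N_free q n \<beta> (q ^ n - 1) > 0" if "Y > 4 * u * W k - 2 * v * W kQ"
    using that main mult_pos_pos[OF scale_pos, of "Y - 4 * u * W k + 2 * v * W kQ"] by linarith
  ultimately show ?thesis unfolding Y_def u_def v_def by blast
qed

end
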